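(* Let $X$ be a real reflexive Banach space, $Y$ a real Hilbert space, $Q$ a reflexive Banach space, $\Theta$ a normed space, and $Z=Q\times\Theta$ with norm $\|(q,\eta)\|_Z=\|q\|_Q+\|\eta\|_\Theta$. Let $U\subset Q$ and $\Sigma\subset\Theta$ be nonempty and weakly closed, and let $\Lambda=U\times\Sigma$. Let $\pi:X\to Y$ be linear and continuous. For every $p\in\Lambda$ let $K_p\subset X$, $A_p:X\to X^*$, $\varphi_p:X\times X\to\mathbb R$, $j_p:X\to\mathbb R$ and $f_p\in Y$ be such that: (1) $K_p$ is a nonempty closed convex subset of $X$; (2) $A_p$ is pseudomonotone, and there is $m_p>0$ with $\langle A_pv_1-A_pv_2,v_1-v_2\rangle\ge m_p\|v_1-v_2\|_X^2$ for all $v_1,v_2\in X$; (3) $\varphi_p(u,\cdot)$ is convex and lower semicontinuous for all $u\in X$, and there is $\alpha_p>0$ with $\varphi_p(u_1,v_2)-\varphi_p(u_1,v_1)+\varphi_p(u_2,v_1)-\varphi_p(u_2,v_2)\le\alpha_p\|u_1-u_2\|_X\|v_1-v_2\|_X$ for all $u_1,u_2,v_1,v_2\in X$; (4) $j_p$ is locally Lipschitz; there are $c_{0p},c_{1p}\ge0$ with $\|\xi\|_{X^*}\le c_{0p}+c_{1p}\|v\|_X$ for all $v\in X$, $\xi\in\partial j_p(v)$; and there is $\beta_p>0$ with $j_p^0(v_1;v_2-v_1)+j_p^0(v_2;v_1-v_2)\le\beta_p\|v_1-v_2\|_X^2$ for all $v_1,v_2\in X$; (5) $\alpha_p+\beta_p<m_p$.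 Let $u(p)=u(q,\eta)$ denote the unique solution of Problem $\mathcal P$ for $p=(q,\eta)\in\Lambda$, and assume that for all sequences $\{p_n\}\subset\Lambda$ and $p\in\Lambda$, $p_n\rightharpoonup p$ in $Z$ implies $u(p_n)\to u(p)$ in $X$. For every $\eta\in\Sigma$ let $F(\eta)\subset U$ be a nonempty weakly closed subset of $Q$. Let $\mathcal L:X\times U\to\mathbb R$ be such that for all sequences $\{u_k\}\subset X$, $\{q_k\}\subset U$ with $u_k\to u$ in $X$ and $q_k\rightharpoonup q$ in $Q$: $$\liminf_{k\to\infty}\mathcal L(u_k,q_k)\ge\mathcal L(u,q),\qquad \lim_{k\to\infty}[\mathcal L(u_k,q_k)-\mathcal L(u,q_k)]=0 .$$ Assume in addition that at least one of the following holds: (i) there is $h:U\to\mathbb R$ such that $\mathcal L(u,q)\ge h(q)$ for all $u\in X$, $q\in U$, and $\|q_k\|_Q\to+\infty$ (with $\{q_k\}\subset U$) implies $h(q_k)\to\infty$; (ii) $U$ is a bounded subset of $Q$. Then for every given $\eta\in\Sigma$ there exists at least one pair $(u^*,q^* )\in\mathcal V_{ad}(\eta)$ such that $$\mathcal L(u^*,q^* )=\min_{(u,q)\in\mathcal V_{ad}(\eta)}\mathcal L(u,q).$$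
   Context: $X^*$ is the dual of $X$, $\langle\cdot,\cdot\rangle$ the duality pairing between $X^*$ and $X$, $(\cdot,\cdot)_Y$ the inner product of $Y$; $\rightharpoonup$ and $\to$ denote weak and strong convergence. Problem $\mathcal P$ for a parameter $p\in\Lambda$: find $u\in K_p$ such that $$\langle A_pu,v-u\rangle+\varphi_p(u,v)-\varphi_p(u,u)+j_p^0(u;v-u)\ge(f_p,\pi v-\pi u)_Y\quad\forall v\in K_p .$$ It is known that, under hypotheses (1)-(5) and the continuity of the linear operator $\pi$, this problem has a unique solution, so $u(p)$ is well defined. Set of admissible pairs: $\mathcal V_{ad}(\eta)=\{(u,q): q\in F(\eta),\ u=u(q,\eta)\}$. An operator $A:X\to X^*$ is pseudomonotone if it maps bounded sets to bounded sets and, whenever $u_n\rightharpoonup u$ in $X$ with $\limsup\langle Au_n,u_n-u\rangle\le0$, one has $\liminf\langle Au_n,u_n-v\rangle\ge\langle Au,u-v\rangle$ for all $v\in X$. For locally Lipschitz $j:X\to\mathbb R$, the Clarke directional derivative is $j^0(x;v)=\limsup_{y\to x,\lambda\downarrow0}\frac{j(y+\lambda v)-j(y)}{\lambda}$ and the Clarke subdifferential is $\partial j(x)=\{\zeta\in X^*: j^0(x;v)\ge\langle\zeta,v\rangle\ \forall v\in X\}$. *)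

theory Defs
  imports "HOL-Analysis.Analysis"
begin

text \<open>
  The weak topology is parametrised by the norm \<open>N\<close>, because the library norm on a product type is
  \<open>sqrt ((norm q)\<^sup>2 + (norm \<eta>)\<^sup>2)\<close>, whereas \<open>Q \<times> \<Theta>\<close> is to carry the sum norm.
\<close>

definition continuous_functional :: "('a::real_vector \<Rightarrow> real) \<Rightarrow> ('a \<Rightarrow> real) \<Rightarrow> bool" where
  "continuous_functional N l \<longleftrightarrow> linear l \<and> (\<exists>C. \<forall>x. \<bar>l x\<bar> \<le> C * N x)"

definition weak_topology_wrt :: "('a::real_vector \<Rightarrow> real) \<Rightarrow> 'a topology" where
  "weak_topology_wrt N =
     topology_generated_by {l -` V | l V. continuous_functional N l \<and> open V}"

abbreviation weak_topology :: "'a::real_normed_vector topology" where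
  "weak_topology \<equiv> weak_topology_wrt norm"

definition weakly_converges_wrt ::
    "('a::real_vector \<Rightarrow> real) \<Rightarrow> (nat \<Rightarrow> 'a) \<Rightarrow> 'a \<Rightarrow> bool" where
  "weakly_converges_wrt N x a \<longleftrightarrow>
     (\<forall>l. continuous_functional N l \<longrightarrow> (\<lambda>n. l (x n)) \<longlonglongrightarrow> l a)"

abbreviation weakly_converges :: "(nat \<Rightarrow> 'a::real_normed_vector) \<Rightarrow> 'a \<Rightarrow> bool" where
  "weakly_converges \<equiv> weakly_converges_wrt norm"

definition sum_norm :: "'q::real_normed_vector \<times> 't::real_normed_vector \<Rightarrow> real" where
  "sum_norm = (\<lambda>(q, \<eta>). norm q + norm \<eta>)"

lemma continuous_functional_norm: "continuous_functional norm l \<longleftrightarrow> bounded_linear l"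
  by (auto simp: continuous_functional_def bounded_linear_def bounded_linear_axioms_def mult.commute)

lemma limitin_weak_topology_wrt:
  "limitin (weak_topology_wrt N) x a sequentially \<longleftrightarrow> weakly_converges_wrt N x a"
proof
  assume lim: "limitin (weak_topology_wrt N) x a sequentially"
  show "weakly_converges_wrt N x a"
    unfolding weakly_converges_wrt_def
  proof (intro allI impI topological_tendstoI)
    fix l and V :: "real set"
    assume l: "continuous_functional N l" and V: "open V" "l a \<in> V"
    have "openin (weak_topology_wrt N) (l -` V)"
      unfolding weak_topology_wrt_def
      using l V by (intro topology_generated_by_Basis) blast
    then show "\<forall>\<^sub>F n in sequentially. l (x n) \<in> V"
      using lim V(2) unfolding limitin_def by fastforce
  qed
next
  assume w: "weakly_converges_wrt N x a"
  let ?B = "{l -` V | l V. continuous_functional N l \<and> open V}"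
  have "\<forall>\<^sub>F n in sequentially. x n \<in> U" if "generate_topology_on ?B U" "a \<in> U" for U
    using that
  proof (induction rule: generate_topology_on.induct)
    case (Int S T)
    then show ?case by (auto intro: eventually_conj)
  next
    case (UN K)
    then obtain S where S: "S \<in> K" "a \<in> S" by blast
    with UN.IH have "\<forall>\<^sub>F n in sequentially. x n \<in> S" by blast
    then show ?case by (rule eventually_mono) (use S in blast)
  next
    case (Basis S)
    then obtain l V where "S = l -` V" "continuous_functional N l" "open V" by blast
    then show ?case
      using w Basis.prems topological_tendstoD[of "\<lambda>n. l (x n)" "l a" sequentially V]
      by (auto simp: weakly_converges_wrt_def)
  qed simp
  moreover have "a \<in> topspace (weak_topology_wrt N)"
  proof -
    have "continuous_functional N (\<lambda>_. 0)"
      by (auto simp: continuous_functional_def linear_iff intro: exI[of _ 0])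
    then have "openin (weak_topology_wrt N) ((\<lambda>_. 0) -` UNIV)"
      unfolding weak_topology_wrt_def by (intro topology_generated_by_Basis) blast
    then show ?thesis using openin_subset by auto
  qed
  ultimately show "limitin (weak_topology_wrt N) x a sequentially"
    unfolding limitin_def weak_topology_wrt_def openin_topology_generated_by_iff by blast
qed

text \<open>Surjectivity of the canonical embedding into the bidual.\<close>

definition reflexive_space :: "'a::real_normed_vector itself \<Rightarrow> bool" where
  "reflexive_space _ \<longleftrightarrow>
     (\<forall>\<Phi> :: ('a \<Rightarrow>\<^sub>L real) \<Rightarrow>\<^sub>L real. \<exists>x::'a. \<forall>l. blinfun_apply \<Phi> l = blinfun_apply l x)"

definition pseudomonotone :: "('a::real_normed_vector \<Rightarrow> ('a \<Rightarrow>\<^sub>L real)) \<Rightarrow> bool" where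
  "pseudomonotone A \<longleftrightarrow>
     (\<forall>B. bounded B \<longrightarrow> bounded (A ` B)) \<and>
     (\<forall>u u0. weakly_converges u u0 \<and>
        limsup (\<lambda>n. ereal (blinfun_apply (A (u n)) (u n - u0))) \<le> 0 \<longrightarrow>
        (\<forall>v. ereal (blinfun_apply (A u0) (u0 - v))
              \<le> liminf (\<lambda>n. ereal (blinfun_apply (A (u n)) (u n - v)))))"

definition lower_semicontinuous :: "('a::topological_space \<Rightarrow> real) \<Rightarrow> bool" where
  "lower_semicontinuous f \<longleftrightarrow> (\<forall>x. ereal (f x) \<le> Liminf (nhds x) (\<lambda>y. ereal (f y)))"

definition locally_Lipschitz :: "('a::metric_space \<Rightarrow> real) \<Rightarrow> bool" where
  "locally_Lipschitz j \<longleftrightarrow> (\<forall>x. \<exists>r>0. \<exists>L. L-lipschitz_on (ball x r) j)"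

text \<open>
  The upper limit is finite whenever \<open>j\<close> is locally Lipschitz, so the conversion back to
  \<^typ>\<open>real\<close> loses nothing there.
\<close>

definition Clarke_dir :: "('a::real_normed_vector \<Rightarrow> real) \<Rightarrow> 'a \<Rightarrow> 'a \<Rightarrow> real" where
  "Clarke_dir j x v = real_of_ereal
     (Limsup (nhds x \<times>\<^sub>F at_right 0)
        (\<lambda>(y, t::real). ereal ((j (y + t *\<^sub>R v) - j y) / t)))"

definition Clarke_subdiff :: "('a::real_normed_vector \<Rightarrow> real) \<Rightarrow> 'a \<Rightarrow> ('a \<Rightarrow>\<^sub>L real) set" where
  "Clarke_subdiff j x = {\<zeta>. \<forall>v. Clarke_dir j x v \<ge> blinfun_apply \<zeta> v}"

definition solves_P ::
    "'x::real_normed_vector set \<Rightarrow> ('x \<Rightarrow> ('x \<Rightarrow>\<^sub>L real)) \<Rightarrow> ('x \<Rightarrow> 'x \<Rightarrow> real) \<Rightarrow> ('x \<Rightarrow> real) \<Rightarrow>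
     'y::real_inner \<Rightarrow> ('x \<Rightarrow> 'y) \<Rightarrow> 'x \<Rightarrow> bool" where
  "solves_P K A \<phi> j f \<pi> u \<longleftrightarrow> u \<in> K \<and>
     (\<forall>v\<in>K. blinfun_apply (A u) (v - u) + \<phi> u v - \<phi> u u + Clarke_dir j u (v - u)
              \<ge> inner f (\<pi> v - \<pi> u))"

text \<open>
  Meaningful only for data for which the problem is uniquely solvable.
\<close>

definition solution_P ::
    "'x::real_normed_vector set \<Rightarrow> ('x \<Rightarrow> ('x \<Rightarrow>\<^sub>L real)) \<Rightarrow> ('x \<Rightarrow> 'x \<Rightarrow> real) \<Rightarrow> ('x \<Rightarrow> real) \<Rightarrow>
     'y::real_inner \<Rightarrow> ('x \<Rightarrow> 'y) \<Rightarrow> 'x" where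
  "solution_P K A \<phi> j f \<pi> = (THE u. solves_P K A \<phi> j f \<pi> u)"

definition admissible_pairs ::
    "('q \<times> 't \<Rightarrow> 'x) \<Rightarrow> ('t \<Rightarrow> 'q set) \<Rightarrow> 't \<Rightarrow> ('x \<times> 'q) set" where
  "admissible_pairs sol F \<eta> = {(u, q). q \<in> F \<eta> \<and> u = sol (q, \<eta>)}"

end

theory Submission
  imports Defs
begin

text \<open>
  For fixed \<open>\<eta>\<close> the reduced cost \<open>g q = \<L> (sol (q, \<eta>)) q\<close> is weakly sequentially lower
  semicontinuous on \<open>F \<eta>\<close> and tends to infinity along sequences with \<open>norm q \<rightarrow> \<infinity>\<close>, so the direct
  method applies once bounded sequences in a reflexive space are known to have weakly convergent
  subsequences.

  That fact rests on the Hahn-Banach theorem in the following form: a sublinear \<open>p\<close> dominates a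
  linear \<open>l\<close> with \<open>l a = p a\<close> at a prescribed point \<open>a\<close>. For \<open>p x = infdist x M\<close> it yields
  functionals that vanish on \<open>M\<close> and norming functionals. For \<open>p l = limsup l (y n)\<close> on the dual,
  reflexivity represents the resulting functional by a point \<open>z\<close> with \<open>l z \<le> limsup l (y n)\<close> for
  all \<open>l\<close>. If \<open>e k (y n)\<close> converges for countably many \<open>e k\<close> that separate the points of the
  closed span of \<open>y\<close>, then \<open>z\<close> does not depend on \<open>a\<close>, whence \<open>limsup a (y n) = a z\<close> for every
  \<open>a\<close>, and this is weak convergence.
\<close>

section \<open>Sublinear functionals and infima of them\<close>

text \<open>Homogeneity is demanded only as an inequality, which is what infima yield directly;
  scaling back by \<open>1 / c\<close> recovers equality in \<open>sublinear_scaleR\<close>.\<close>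

definition sublinear :: "('a::real_vector \<Rightarrow> real) \<Rightarrow> bool" where
  "sublinear p \<longleftrightarrow> (\<forall>x y. p (x + y) \<le> p x + p y) \<and> (\<forall>c x. 0 \<le> c \<longrightarrow> p (c *\<^sub>R x) \<le> c * p x)"

lemma sublinearI:
  assumes "\<And>x y. p (x + y) \<le> p x + p y" "\<And>c x. 0 \<le> c \<Longrightarrow> p (c *\<^sub>R x) \<le> c * p x"
  shows "sublinear p"
  using assms by (auto simp: sublinear_def)

lemma sublinear_add: "sublinear p \<Longrightarrow> p (x + y) \<le> p x + p y"
  by (simp add: sublinear_def)

lemma sublinear_0: "sublinear p \<Longrightarrow> p 0 = 0"
  unfolding sublinear_def
  by (metis add_0 le_add_same_cancel1 mult_zero_left order_antisym order_refl scaleR_zero_left)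

lemma sublinear_scaleR:
  assumes "sublinear p" "0 \<le> c"
  shows "p (c *\<^sub>R x) = c * p x"
proof (cases "c = 0")
  case True
  then show ?thesis using sublinear_0[OF assms(1)] by simp
next
  case False
  then have c: "0 < c" using assms(2) by simp
  have "p ((1 / c) *\<^sub>R (c *\<^sub>R x)) \<le> (1 / c) * p (c *\<^sub>R x)"
    using assms c unfolding sublinear_def by (meson divide_nonneg_nonneg zero_le_one)
  then have "c * p x \<le> p (c *\<^sub>R x)"
    using c by (simp add: field_simps)
  then show ?thesis
    using assms by (simp add: sublinear_def order_antisym)
qed

lemma sublinear_minus_le: "sublinear p \<Longrightarrow> - p (- x) \<le> p x"
  using sublinear_add[of p x "- x"] sublinear_0[of p] by simp

text \<open>The infima are taken one at a time, first over \<open>b\<close> with \<open>a\<close>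
  fixed. This gives subadditivity of functionals defined by infima, as \<open>le_mult_cINF\<close>
  gives homogeneity.\<close>

lemma le_cINF_add:
  fixes f :: "'a \<Rightarrow> real" and g :: "'b \<Rightarrow> real"
  assumes "A \<noteq> {}" "B \<noteq> {}" and le: "\<And>a b. a \<in> A \<Longrightarrow> b \<in> B \<Longrightarrow> c \<le> f a + g b"
  shows "c \<le> (INF a\<in>A. f a) + (INF b\<in>B. g b)"
proof -
  have "c - f a \<le> (INF b\<in>B. g b)" if a: "a \<in> A" for a
    using assms(2) by (rule cINF_greatest) (use le[OF a] in \<open>simp add: diff_le_eq add.commute\<close>)
  then have le': "c - (INF b\<in>B. g b) \<le> f a" if "a \<in> A" for a
    using that by fastforce
  have "c - (INF b\<in>B. g b) \<le> (INF a\<in>A. f a)"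
    using assms(1) by (rule cINF_greatest) (rule le')
  then show ?thesis by simp
qed

lemma le_mult_cINF:
  fixes f :: "'a \<Rightarrow> real"
  assumes "A \<noteq> {}" "0 \<le> k" and le: "\<And>a. a \<in> A \<Longrightarrow> c \<le> k * f a"
  shows "c \<le> k * (INF a\<in>A. f a)"
proof (cases "k = 0")
  case True
  then show ?thesis using assms(1) le by auto
next
  case False
  then have "c / k \<le> (INF a\<in>A. f a)"
    using assms by (intro cINF_greatest) (auto simp: field_simps)
  then show ?thesis using False assms(2) by (simp add: field_simps)
qed

text \<open>Lower bounds of chains for Zorn's lemma. The infimum is finite because
  \<open>- p (- x) \<le> f x\<close> for every member, and subadditive because two members of a
  chain have one of them below both.\<close>

lemma sublinear_chain_INF:
  fixes C :: "('a::real_vector \<Rightarrow> real) set"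
  assumes C: "C \<noteq> {}" "\<And>f. f \<in> C \<Longrightarrow> sublinear f \<and> f \<le> p"
    and chain: "\<And>f g. f \<in> C \<Longrightarrow> g \<in> C \<Longrightarrow> f \<le> g \<or> g \<le> f"
  shows "sublinear (\<lambda>x. INF f\<in>C. f x)" and "f \<in> C \<Longrightarrow> (\<lambda>x. INF f\<in>C. f x) \<le> f"
proof -
  have bdd: "bdd_below ((\<lambda>f. f x) ` C)" for x
  proof (rule bdd_belowI2)
    fix f assume f: "f \<in> C"
    then have "f (- x) \<le> p (- x)" using C(2) by (simp add: le_fun_def)
    then show "- p (- x) \<le> f x"
      using sublinear_minus_le[of f x] C(2) f by fastforce
  qed
  let ?q = "\<lambda>x. INF f\<in>C. f x"
  have le: "?q x \<le> f x" if "f \<in> C" for f x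
    using bdd that by (rule cINF_lower)
  show "f \<in> C \<Longrightarrow> ?q \<le> f"
    using le by (simp add: le_fun_def)
  show "sublinear ?q"
  proof (rule sublinearI)
    fix x y
    have "?q (x + y) \<le> f x + g y" if fg: "f \<in> C" "g \<in> C" for f g
    proof -
      obtain h where h: "h \<in> C" "h \<le> f" "h \<le> g"
        using chain[OF fg] fg by blast
      have "?q (x + y) \<le> h x + h y"
        using le[OF h(1), of "x + y"] sublinear_add[of h x y] C(2) h(1) by fastforce
      then show ?thesis
        using h(2,3) by (smt (verit) le_fun_def)
    qed
    then show "?q (x + y) \<le> ?q x + ?q y"
      by (intro le_cINF_add C(1))
  next
    fix c :: real and x
    assume c: "0 \<le> c"
    have *: "?q (c *\<^sub>R x) \<le> c * f x" if "f \<in> C" for f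
      using le[OF that, of "c *\<^sub>R x"] sublinear_scaleR[of f c x] C(2) that c by auto
    show "?q (c *\<^sub>R x) \<le> c * ?q x"
      by (rule le_mult_cINF[OF C(1) c *])
  qed
qed

text \<open>The tilt \<open>q\<close> lies below \<open>p\<close> and is pushed down at
  \<open>- a\<close>, where \<open>t = 1\<close> gives the value \<open>- p a\<close>. It is finite
  since \<open>t * p a = p (t *\<^sub>R a) \<le> p (x + t *\<^sub>R a) + p (- x)\<close>.\<close>

lemma sublinear_tilt:
  fixes p :: "'a::real_vector \<Rightarrow> real" and a :: 'a
  assumes p: "sublinear p"
  defines "\<And>x. q x \<equiv> INF t\<in>{0..}. p (x + t *\<^sub>R a) - t * p a"
  shows "sublinear q" "q \<le> p" "q (- a) \<le> - p a"
proof -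
  have bdd: "bdd_below ((\<lambda>t. p (x + t *\<^sub>R a) - t * p a) ` {0..})" for x
  proof (rule bdd_belowI2)
    fix t :: real assume "t \<in> {0..}"
    then show "- p (- x) \<le> p (x + t *\<^sub>R a) - t * p a"
      using sublinear_add[OF p, of "x + t *\<^sub>R a" "- x"] sublinear_scaleR[OF p, of t a] by simp
  qed
  have le: "q x \<le> p (x + t *\<^sub>R a) - t * p a" if "0 \<le> t" for t x
    unfolding q_def using bdd that by (intro cINF_lower) auto
  show "q \<le> p"
    using le[of 0] by (simp add: le_fun_def)
  show "q (- a) \<le> - p a"
    using le[of 1 "- a"] sublinear_0[OF p] by simp
  show "sublinear q"
  proof (rule sublinearI)
    fix x y
    \<comment> \<open>Parameters \<open>s\<close> for \<open>x\<close> and \<open>t\<close> for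
      \<open>y\<close> combine to \<open>s + t\<close> for \<open>x + y\<close>; likewise
      \<open>c * t\<close> is used for \<open>c *\<^sub>R x\<close> below.\<close>
    have "q (x + y) \<le> (p (x + s *\<^sub>R a) - s * p a) + (p (y + t *\<^sub>R a) - t * p a)"
      if "0 \<le> s" "0 \<le> t" for s t
      using le[of "s + t" "x + y"] that sublinear_add[OF p, of "x + s *\<^sub>R a" "y + t *\<^sub>R a"]
      by (simp add: algebra_simps)
    then show "q (x + y) \<le> q x + q y"
      unfolding q_def[of x] q_def[of y] by (intro le_cINF_add) auto
  next
    fix c :: real and x
    assume c: "0 \<le> c"
    have "q (c *\<^sub>R x) \<le> c * (p (x + t *\<^sub>R a) - t * p a)" if "0 \<le> t" for t
      using le[of "c * t" "c *\<^sub>R x"] that c sublinear_scaleR[OF p c, of "x + t *\<^sub>R a"]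
      by (simp add: algebra_simps)
    then show "q (c *\<^sub>R x) \<le> c * q x"
      unfolding q_def[of x] using c by (intro le_mult_cINF) auto
  qed
qed

section \<open>The Hahn-Banach theorem\<close>

text \<open>Tilting at \<open>x\<close> cannot change a minimal \<open>p\<close>, so
  \<open>p (- x) \<le> - p x\<close> and \<open>p\<close> is odd. Subadditivity at
  \<open>- x\<close> and \<open>- y\<close> then becomes the reverse inequality at \<open>x\<close>
  and \<open>y\<close>.\<close>

lemma minimal_sublinear_linear:
  fixes p :: "'a::real_vector \<Rightarrow> real"
  assumes p: "sublinear p" and min: "\<And>q. sublinear q \<Longrightarrow> q \<le> p \<Longrightarrow> q = p"
  shows "linear p"
proof -
  have minus: "p (- x) = - p x" for x
  proof -
    note q = sublinear_tilt[OF p, of x]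
    have "p (- x) \<le> - p x"
      using q(3) fun_cong[OF min[OF q(1,2)], of "- x"] by simp
    then show ?thesis using sublinear_minus_le[OF p, of x] by simp
  qed
  show ?thesis
  proof (rule linearI)
    fix x y
    show "p (x + y) = p x + p y"
      using sublinear_add[OF p, of x y] sublinear_add[OF p, of "- x" "- y"] minus[of "x + y"]
      by (simp add: minus)
  next
    fix c :: real and x
    show "p (c *\<^sub>R x) = c *\<^sub>R p x"
      using sublinear_scaleR[OF p, of c x] sublinear_scaleR[OF p, of "- c" x] minus[of "c *\<^sub>R x"]
      by (cases "0 \<le> c") auto
  qed
qed

lemma linear_below_sublinear:
  fixes p :: "'a::real_vector \<Rightarrow> real"
  assumes p: "sublinear p"
  obtains l where "linear l" "l \<le> p"
proof -
  \<comment> \<open>The order is reversed: the maximal element that Zorn's lemma delivers for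
    \<open>?P\<close> is a minimal sublinear functional.\<close>
  let ?A = "{q. sublinear q \<and> q \<le> p}" and ?P = "\<lambda>f g :: 'a \<Rightarrow> real. g \<le> f"
  have "\<exists>m\<in>?A. \<forall>a\<in>?A. ?P m a \<longrightarrow> a = m"
  proof (rule predicate_Zorn)
    show "partial_order_on ?A (relation_of ?P ?A)"
      by (rule partial_order_on_relation_ofI) auto
  next
    fix C assume "C \<in> Chains (relation_of ?P ?A)"
    then have C: "C \<subseteq> ?A" "\<And>f g. f \<in> C \<Longrightarrow> g \<in> C \<Longrightarrow> f \<le> g \<or> g \<le> f"
      by (auto simp: Chains_def relation_of_def)
    show "\<exists>u\<in>?A. \<forall>a\<in>C. ?P a u"
    proof (cases "C = {}")
      case True
      then show ?thesis using p by auto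
    next
      case False
      let ?q = "\<lambda>x. INF f\<in>C. f x"
      have "sublinear ?q"
        using False C by (intro sublinear_chain_INF(1)[of C p]) auto
      moreover have le: "?q \<le> f" if "f \<in> C" for f
        using False C that by (intro sublinear_chain_INF(2)[of C p]) auto
      moreover obtain f where "f \<in> C" "f \<le> p"
        using False C(1) by blast
      then have "?q \<le> p"
        by (intro order_trans[OF le])
      ultimately show ?thesis by blast
    qed
  qed
  then obtain l where l: "sublinear l" "l \<le> p" and "\<And>q. sublinear q \<Longrightarrow> q \<le> p \<Longrightarrow> q \<le> l \<Longrightarrow> q = l"
    by auto
  then have "linear l"
    by (intro minimal_sublinear_linear) (auto intro: order_trans)
  with l that show ?thesis by blast
qed

text \<open>The linear functional is chosen below the tilt of \<open>p\<close> at \<open>a\<close>,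
  not merely below \<open>p\<close>: then \<open>l (- a) \<le> - p a\<close>, that is,
  \<open>p a \<le> l a\<close>.\<close>

theorem Hahn_Banach_sublinear:
  fixes p :: "'a::real_vector \<Rightarrow> real"
  assumes p: "sublinear p"
  obtains l where "linear l" "\<And>x. l x \<le> p x" "l a = p a"
proof -
  let ?q = "\<lambda>x. INF t\<in>{0..}. p (x + t *\<^sub>R a) - t * p a"
  note q = sublinear_tilt[OF p, of a]
  obtain l where l: "linear l" "l \<le> ?q"
    using linear_below_sublinear[OF q(1)] by blast
  have le: "l x \<le> p x" for x
    using order_trans[OF l(2) q(2)] by (rule le_funD)
  have "l (- a) \<le> - p a"
    using le_funD[OF l(2), of "- a"] q(3) by (rule order_trans)
  then have "l a = p a"
    using le[of a] l(1) by (simp add: linear_neg)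
  with l(1) le that show ?thesis by blast
qed

section \<open>Continuous functionals on normed spaces\<close>

text \<open>This is the quotient seminorm modulo \<open>M\<close>: approximations of
  \<open>x\<close> and \<open>y\<close> from \<open>M\<close> add and scale within
  \<open>M\<close>.\<close>

lemma sublinear_infdist:
  fixes M :: "'a::real_normed_vector set"
  assumes M: "subspace M"
  shows "sublinear (\<lambda>x. infdist x M)"
proof -
  have ne: "M \<noteq> {}" using subspace_0[OF M] by blast
  show ?thesis
  proof (rule sublinearI)
    fix x y
    have "infdist (x + y) M \<le> dist x u + dist y v" if "u \<in> M" "v \<in> M" for u v
    proof -
      have "infdist (x + y) M \<le> dist (x + y) (u + v)"
        using that subspace_add[OF M] by (intro infdist_le) auto
      also have "\<dots> \<le> dist x u + dist y v"
        by (rule dist_triangle_add)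
      finally show ?thesis .
    qed
    then show "infdist (x + y) M \<le> infdist x M + infdist y M"
      unfolding infdist_notempty[OF ne, of x] infdist_notempty[OF ne, of y]
      by (intro le_cINF_add ne)
  next
    fix c :: real and x
    assume c: "0 \<le> c"
    have le: "infdist (c *\<^sub>R x) M \<le> c * dist x u" if "u \<in> M" for u
    proof -
      have "infdist (c *\<^sub>R x) M \<le> dist (c *\<^sub>R x) (c *\<^sub>R u)"
        using that subspace_scale[OF M] by (intro infdist_le) auto
      then show ?thesis using c by (simp add: dist_norm flip: scaleR_diff_right)
    qed
    show "infdist (c *\<^sub>R x) M \<le> c * infdist x M"
      unfolding infdist_notempty[OF ne, of x] by (rule le_mult_cINF[OF ne c le])
  qed
qed

lemma bounded_linear_if_le_norm:
  fixes l :: "'a::real_normed_vector \<Rightarrow> real"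
  assumes "linear l" "\<And>x. l x \<le> C * norm x"
  shows "bounded_linear l" "\<bar>l x\<bar> \<le> C * norm x"
proof -
  show abs: "\<bar>l x\<bar> \<le> C * norm x" for x
    using assms(2)[of x] assms(2)[of "- x"] linear_neg[OF assms(1), of x] by (simp add: abs_le_iff)
  show "bounded_linear l"
    using assms(1) abs by (intro bounded_linear_intro[of l C])
      (auto simp: linear_add linear_cmul mult.commute)
qed

text \<open>The Hahn-Banach theorem is applied to the distance from \<open>M\<close>, tight at
  \<open>a\<close>. The distance vanishes at \<open>x\<close> and \<open>- x\<close> for
  \<open>x\<close> in \<open>M\<close>, and is at most the norm because \<open>0\<close> lies in
  \<open>M\<close>.\<close>

lemma subspace_distance_functional:
  fixes M :: "'a::real_normed_vector set"
  assumes M: "subspace M"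
  obtains l :: "'a \<Rightarrow>\<^sub>L real" where "\<And>x. x \<in> M \<Longrightarrow> blinfun_apply l x = 0" "blinfun_apply l a = infdist a M"
    "\<And>x. \<bar>blinfun_apply l x\<bar> \<le> norm x"
proof -
  obtain l where l: "linear l" "\<And>x. l x \<le> infdist x M" "l a = infdist a M"
    using Hahn_Banach_sublinear[OF sublinear_infdist[OF M]] by blast
  have "l x \<le> 1 * norm x" for x
    using l(2)[of x] infdist_le[OF subspace_0[OF M], of x] by simp
  note bl = bounded_linear_if_le_norm[OF l(1) this]
  have "l x = 0" if "x \<in> M" for x
    using l(2)[of x] l(2)[of "- x"] that subspace_neg[OF M] linear_neg[OF l(1), of x] by fastforce
  then show ?thesis
    using that[of "Blinfun l"] bl l(3) by (simp add: bounded_linear_Blinfun_apply)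
qed

section \<open>Separable subspaces and pointwise convergent subsequences\<close>

text \<open>\<open>d\<close> enumerates the rational combinations of the \<open>x n\<close>. Their
  closure admits real scalars because these are limits of rationals.\<close>

lemma separable_subspace_containing_range:
  fixes x :: "nat \<Rightarrow> 'a::real_normed_vector"
  obtains d :: "nat \<Rightarrow> 'a" where "subspace (closure (range d))" "range x \<subseteq> closure (range d)"
proof -
  \<comment> \<open>A combination is coded by a list of coefficients and indices, a countable type
    enumerated by \<open>from_nat\<close>; addition is concatenation.\<close>
  define c :: "(rat \<times> nat) list \<Rightarrow> 'a" where
    "c rs = (\<Sum>(r, n)\<leftarrow>rs. of_rat r *\<^sub>R x n)" for rs
  define d where "d k = c (from_nat k)" for k
  have range_d: "range d = range c"
    unfolding d_def image_image[of c from_nat, symmetric] by (simp add: surj_from_nat)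
  have add: "u + v \<in> range c" if uv: "u \<in> range c" "v \<in> range c" for u v
  proof -
    obtain rs ss where "u = c rs" "v = c ss" using uv by blast
    then have "u + v = c (rs @ ss)" by (simp add: c_def)
    then show ?thesis by blast
  qed
  have scale: "of_rat r *\<^sub>R u \<in> range c" if u: "u \<in> range c" for r u
  proof -
    obtain rs where rs: "u = c rs" using u by blast
    have "of_rat r *\<^sub>R c rs = c (map (\<lambda>(s, n). (r * s, n)) rs)"
      by (induction rs) (auto simp: c_def scaleR_right_distrib of_rat_mult)
    then show ?thesis using rs by blast
  qed
  have "subspace (closure (range d))"
    unfolding range_d
  proof (rule subspaceI)
    have "c [] = 0" by (simp add: c_def)
    then show "0 \<in> closure (range c)"
      using closure_subset by (metis rangeI subsetD)
  next
    fix u v assume "u \<in> closure (range c)" "v \<in> closure (range c)"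
    then obtain f g where "\<forall>n. f n \<in> range c" "f \<longlonglongrightarrow> u" "\<forall>n. g n \<in> range c" "g \<longlonglongrightarrow> v"
      unfolding closure_sequential by blast
    then show "u + v \<in> closure (range c)"
      unfolding closure_sequential using add tendsto_add[of f u sequentially g v]
      by (intro exI[of _ "\<lambda>n. f n + g n"]) blast
  next
    fix r :: real and u assume "u \<in> closure (range c)"
    then obtain f where f: "\<forall>n. f n \<in> range c" "f \<longlonglongrightarrow> u"
      unfolding closure_sequential by blast
    have "r \<in> closure \<rat>" by (simp add: Rats_closure_real)
    then obtain s where s: "\<forall>n. s n \<in> \<rat>" "s \<longlonglongrightarrow> r"
      unfolding closure_sequential by blast
    have "s n *\<^sub>R f n \<in> range c" for n
      using scale f(1) s(1) by (metis Rats_cases)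
    then show "r *\<^sub>R u \<in> closure (range c)"
      unfolding closure_sequential using tendsto_scaleR[OF s(2) f(2)]
      by (intro exI[of _ "\<lambda>n. s n *\<^sub>R f n"]) blast
  qed
  moreover have "x n = c [(1, n)]" for n by (simp add: c_def)
  then have "range x \<subseteq> closure (range d)"
    unfolding range_d using closure_subset by (metis image_subset_iff rangeI subsetD)
  ultimately show ?thesis using that by blast
qed

text \<open>A product of compact intervals is compact, and with countably many factors first
  countable, hence sequentially compact; this replaces a diagonal argument.\<close>

lemma pointwise_convergent_subsequence:
  fixes f :: "nat \<Rightarrow> nat \<Rightarrow> real"
  assumes "\<And>n k. \<bar>f n k\<bar> \<le> B k"
  shows "\<exists>r g. strict_mono (r :: nat \<Rightarrow> nat) \<and> (\<forall>k. (\<lambda>n. f (r n) k) \<longlonglongrightarrow> g k)"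
proof -
  let ?S = "Pi\<^sub>E UNIV (\<lambda>k. {- B k..B k})"
  have "compactin (product_topology (\<lambda>k::nat. euclidean :: real topology) UNIV) ?S"
    by (simp add: compactin_PiE)
  then have "compact ?S"
    by (simp add: euclidean_product_topology)
  then have "seq_compact ?S"
    by (rule compact_imp_seq_compact)
  moreover have "\<And>n. f n \<in> ?S"
    using assms by (auto simp: abs_le_iff minus_le_iff)
  ultimately obtain g r where r: "strict_mono r" "(f \<circ> r) \<longlonglongrightarrow> g"
    using seq_compactE by metis
  have "(\<lambda>n. f (r n) k) \<longlonglongrightarrow> g k" for k
    using continuous_on_tendsto_compose[OF continuous_on_product_coordinates[of k] r(2)] by (simp add: o_def)
  with r(1) show ?thesis by blast
qed

section \<open>Weak sequential compactness in reflexive spaces\<close>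

text \<open>The bound \<open>B * norm l\<close> makes the upper limit finite and the Hahn-Banach
  functional on the dual continuous, so that reflexivity turns it into evaluation at a
  point.\<close>

lemma reflexive_limsup_point:
  fixes y :: "nat \<Rightarrow> 'a::real_normed_vector" and a :: "'a \<Rightarrow>\<^sub>L real"
  assumes refl: "reflexive_space TYPE('a)" and bdd: "bounded (range y)"
  obtains x where "\<And>l :: 'a \<Rightarrow>\<^sub>L real. ereal (blinfun_apply l x) \<le> limsup (\<lambda>n. ereal (blinfun_apply l (y n)))"
    "ereal (blinfun_apply a x) = limsup (\<lambda>n. ereal (blinfun_apply a (y n)))"
proof -
  obtain B where B: "\<And>n. norm (y n) \<le> B"
    using bdd by (auto simp: bounded_iff)
  define p :: "('a \<Rightarrow>\<^sub>L real) \<Rightarrow> real" where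
    "p l = real_of_ereal (limsup (\<lambda>n. ereal (blinfun_apply l (y n))))" for l
  have abs: "\<bar>blinfun_apply l (y n)\<bar> \<le> B * norm l" for l n
    using norm_blinfun[of l "y n"] mult_right_mono[OF B[of n] norm_ge_zero[of l]]
    by (simp add: mult.commute)
  have upper: "limsup (\<lambda>n. ereal (blinfun_apply l (y n))) \<le> ereal (B * norm l)" for l
    using abs by (intro Limsup_bounded always_eventually) (auto simp: abs_le_iff)
  have lower: "ereal (- (B * norm l)) \<le> limsup (\<lambda>n. ereal (blinfun_apply l (y n)))" for l
    using abs[of l] by (intro le_Limsup always_eventually) (auto simp: abs_le_iff minus_le_iff)
  have p: "limsup (\<lambda>n. ereal (blinfun_apply l (y n))) = ereal (p l)" for l
    using lower[of l] upper[of l] unfolding p_def by (intro ereal_real'[symmetric]) auto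
  have "sublinear p"
  proof (rule sublinearI)
    fix l k
    have "ereal (p (l + k)) \<le> ereal (p l) + ereal (p k)"
      using ereal_limsup_add_mono[of "\<lambda>n. ereal (blinfun_apply l (y n))" "\<lambda>n. ereal (blinfun_apply k (y n))"]
      by (simp flip: p add: plus_blinfun.rep_eq)
    then show "p (l + k) \<le> p l + p k" by simp
  next
    fix c :: real and l
    assume c: "0 \<le> c"
    have "ereal (p (c *\<^sub>R l)) = ereal c * ereal (p l)"
      using limsup_ereal_mult_left[OF c, of "\<lambda>n. ereal (blinfun_apply l (y n))"]
      by (simp flip: p add: scaleR_blinfun.rep_eq)
    then show "p (c *\<^sub>R l) \<le> c * p l" by simp
  qed
  then obtain \<Phi> where \<Phi>: "linear \<Phi>" "\<And>l. \<Phi> l \<le> p l" "\<Phi> a = p a"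
    using Hahn_Banach_sublinear by blast
  have "\<Phi> l \<le> B * norm l" for l
    using \<Phi>(2)[of l] upper[of l] p[of l] by simp
  then have "bounded_linear \<Phi>"
    by (rule bounded_linear_if_le_norm(1)[OF \<Phi>(1)])
  then obtain x where "\<And>l. \<Phi> l = blinfun_apply l x"
    using refl unfolding reflexive_space_def by (metis bounded_linear_Blinfun_apply)
  then show ?thesis
    using that[of x] \<Phi>(2,3) by (simp add: p)
qed

theorem reflexive_bounded_weakly_convergent_subsequence:
  fixes x :: "nat \<Rightarrow> 'a::real_normed_vector"
  assumes refl: "reflexive_space TYPE('a)" and bdd: "bounded (range x)"
  obtains z r where "strict_mono r" "weakly_converges (x \<circ> r) z"
proof -
  obtain d :: "nat \<Rightarrow> 'a" where M: "subspace (closure (range d))" "range x \<subseteq> closure (range d)"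
    by (rule separable_subspace_containing_range)
  let ?M = "closure (range d)"
  \<comment> \<open>The distance to the zero subspace is the norm, so these are norming functionals
    of the \<open>d k\<close>.\<close>
  have "\<exists>e :: 'a \<Rightarrow>\<^sub>L real. blinfun_apply e (d k) = norm (d k) \<and> (\<forall>v. \<bar>blinfun_apply e v\<bar> \<le> norm v)" for k
    by (rule subspace_distance_functional[OF subspace_single_0, of "d k"]) (auto simp: infdist_def)
  then obtain e :: "nat \<Rightarrow> 'a \<Rightarrow>\<^sub>L real" where
    e: "\<And>k. blinfun_apply (e k) (d k) = norm (d k)" "\<And>k v. \<bar>blinfun_apply (e k) v\<bar> \<le> norm v"
    by metis
  \<comment> \<open>If all \<open>e k\<close> vanish at \<open>v\<close>, then
    \<open>norm (d k) \<le> norm (d k - v)\<close>, so members of \<open>range d\<close> that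
    approximate \<open>v\<close> tend to \<open>0\<close>.\<close>
  have separating: "v = 0" if v: "v \<in> ?M" and zero: "\<And>k. blinfun_apply (e k) v = 0" for v
  proof -
    obtain w where w: "\<And>n. w n \<in> range d" "w \<longlonglongrightarrow> v"
      using v unfolding closure_sequential by blast
    have "norm (d k) \<le> norm (d k - v)" for k
      using e(2)[of k "d k - v"] by (simp add: blinfun.diff_right zero e(1))
    then have "norm (w n) \<le> norm (w n - v)" for n
      using w(1)[of n] by auto
    moreover have "(\<lambda>n. norm (w n - v)) \<longlonglongrightarrow> 0"
      using w(2) by (simp add: LIM_zero tendsto_norm_zero)
    ultimately have "w \<longlonglongrightarrow> 0"
      by (intro Lim_null_comparison[of w "\<lambda>n. norm (w n - v)"]) auto
    then show ?thesis
      using w(2) LIMSEQ_unique by blast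
  qed
  obtain B where "\<And>n. norm (x n) \<le> B"
    using bdd by (auto simp: bounded_iff)
  then have bound: "\<bar>blinfun_apply (e k) (x n)\<bar> \<le> B" for n k
    using e(2) order_trans by blast
  obtain r g where r: "strict_mono r" and g: "\<And>k. (\<lambda>n. blinfun_apply (e k) (x (r n))) \<longlonglongrightarrow> g k"
    using pointwise_convergent_subsequence[of "\<lambda>n k. blinfun_apply (e k) (x n)" "\<lambda>_. B", OF bound] by blast
  define y where "y = x \<circ> r"
  have y: "bounded (range y)" "\<And>n. y n \<in> ?M"
    using bdd M(2) by (auto simp: y_def intro: bounded_subset)
  let ?limsup = "\<lambda>l. limsup (\<lambda>n. ereal (blinfun_apply l (y n)))"
  \<comment> \<open>Domination at both \<open>l\<close> and \<open>- l\<close> determines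
    \<open>l\<close> at \<open>v\<close> as soon as \<open>l\<close> converges along
    \<open>y\<close>.\<close>
  have limit: "blinfun_apply l v = c"
    if v: "\<And>l. ereal (blinfun_apply l v) \<le> ?limsup l" and c: "(\<lambda>n. blinfun_apply l (y n)) \<longlonglongrightarrow> c"
    for v c and l :: "'a \<Rightarrow>\<^sub>L real"
  proof (rule antisym)
    show "blinfun_apply l v \<le> c"
      using v[of l] lim_imp_Limsup[OF sequentially_bot tendsto_ereal[OF c]] by simp
    show "c \<le> blinfun_apply l v"
      using v[of "- l"] lim_imp_Limsup[OF sequentially_bot tendsto_ereal[OF tendsto_minus[OF c]]]
      by (simp add: uminus_blinfun.rep_eq)
  qed
  \<comment> \<open>A functional that vanishes on \<open>?M\<close> is zero along \<open>y\<close>,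
    hence zero at \<open>v\<close>; the one chosen here has the value \<open>infdist v ?M\<close>
    there.\<close>
  have mem: "v \<in> ?M" if v: "\<And>l. ereal (blinfun_apply l v) \<le> ?limsup l" for v
  proof -
    obtain l :: "'a \<Rightarrow>\<^sub>L real" where l: "\<And>u. u \<in> ?M \<Longrightarrow> blinfun_apply l u = 0"
        "blinfun_apply l v = infdist v ?M"
      using subspace_distance_functional[OF M(1)] by blast
    have "infdist v ?M = 0"
      using limit[OF v, of l 0] l y(2) by simp
    then show ?thesis
      using subspace_0[OF M(1)] in_closed_iff_infdist_zero[of ?M v] by blast
  qed
  have unique: "v = w"
    if v: "\<And>l. ereal (blinfun_apply l v) \<le> ?limsup l" and w: "\<And>l. ereal (blinfun_apply l w) \<le> ?limsup l" for v w
  proof -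
    have lim: "(\<lambda>n. blinfun_apply (e k) (y n)) \<longlonglongrightarrow> g k" for k
      using g by (simp add: y_def)
    have "blinfun_apply (e k) (v - w) = 0" for k
      using limit[OF v lim[of k]] limit[OF w lim[of k]] by (simp add: blinfun.diff_right)
    then have "v - w = 0"
      using separating subspace_diff[OF M(1) mem[OF v] mem[OF w]] by blast
    then show ?thesis by simp
  qed
  obtain z where z: "\<And>l. ereal (blinfun_apply l z) \<le> ?limsup l"
    using reflexive_limsup_point[OF refl y(1)] by metis
  \<comment> \<open>The point attaining the upper limit at \<open>l\<close> depends on
    \<open>l\<close> a priori; uniqueness identifies it with \<open>z\<close>.\<close>
  have limsup_eq: "?limsup l = ereal (blinfun_apply l z)" for l
    using reflexive_limsup_point[OF refl y(1), of l] unique[OF z] by metis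
  have "(\<lambda>n. blinfun_apply l (y n)) \<longlonglongrightarrow> blinfun_apply l z" for l :: "'a \<Rightarrow>\<^sub>L real"
  proof -
    \<comment> \<open>The identity at \<open>- l\<close> gives the lower limit at \<open>l\<close>,
      which thus agrees with the upper one.\<close>
    have "- liminf (\<lambda>n. ereal (blinfun_apply l (y n))) = ereal (- blinfun_apply l z)"
      using limsup_eq[of "- l"] ereal_Limsup_uminus[of sequentially "\<lambda>n. ereal (blinfun_apply l (y n))"]
      by (simp add: uminus_blinfun.rep_eq)
    then have "liminf (\<lambda>n. ereal (blinfun_apply l (y n))) = ereal (blinfun_apply l z)"
      by (metis ereal_uminus_uminus uminus_ereal.simps(1))
    then have "(\<lambda>n. ereal (blinfun_apply l (y n))) \<longlonglongrightarrow> ereal (blinfun_apply l z)"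
      by (intro iffD2[OF tendsto_iff_Liminf_eq_Limsup]) (simp_all add: limsup_eq)
    then show ?thesis by simp
  qed
  then have "weakly_converges y z"
    unfolding weakly_converges_wrt_def continuous_functional_norm
    by (metis bounded_linear_Blinfun_apply)
  then show ?thesis
    using that r by (simp add: y_def)
qed

section \<open>The direct method\<close>

text \<open>This brings sequences with frozen \<open>\<eta>\<close> under the continuity hypothesis
  on the solution map. A functional on the product splits as
  \<open>l (v, 0) + l (0, \<eta>)\<close>, and its first part is continuous in
  \<open>v\<close>.\<close>

lemma weakly_converges_sum_norm_Pair:
  fixes q :: "nat \<Rightarrow> 'a::real_normed_vector" and \<eta> :: "'b::real_normed_vector"
  assumes "weakly_converges q q'"
  shows "weakly_converges_wrt sum_norm (\<lambda>n. (q n, \<eta>)) (q', \<eta>)"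
  unfolding weakly_converges_wrt_def
proof (intro allI impI)
  fix l :: "'a \<times> 'b \<Rightarrow> real"
  assume l: "continuous_functional sum_norm l"
  then have lin: "linear l" and "\<exists>C. \<forall>z. \<bar>l z\<bar> \<le> C * sum_norm z"
    by (auto simp: continuous_functional_def)
  then obtain C where C: "\<And>z. \<bar>l z\<bar> \<le> C * sum_norm z" by blast
  have split: "l (v, \<eta>) = l (v, 0) + l (0, \<eta>)" for v
    using linear_add[OF lin, of "(v, 0)" "(0, \<eta>)"] by simp
  have "continuous_functional norm (\<lambda>v. l (v, 0))"
    unfolding continuous_functional_def
  proof
    show "linear (\<lambda>v. l (v, 0))"
      using linear_add[OF lin, of "(_, 0)" "(_, 0)"] linear_cmul[OF lin, of _ "(_, 0)"]
      by (auto intro!: linearI)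
    show "\<exists>C. \<forall>v. \<bar>l (v, 0)\<bar> \<le> C * norm v"
      using C[of "(_, 0)"] by (auto simp: sum_norm_def)
  qed
  then have "(\<lambda>n. l (q n, 0)) \<longlonglongrightarrow> l (q', 0)"
    using assms unfolding weakly_converges_wrt_def by blast
  then show "(\<lambda>n. l (q n, \<eta>)) \<longlonglongrightarrow> l (q', \<eta>)"
    unfolding split[of q'] split[of "q _"] by (intro tendsto_add tendsto_const)
qed

lemma weakly_sequentially_lsc_attains_min:
  fixes G :: "'a::real_normed_vector set" and g :: "'a \<Rightarrow> real"
  assumes refl: "reflexive_space TYPE('a)" and G: "G \<noteq> {}" "closedin weak_topology G"
    and lsc: "\<And>q q'. (\<forall>n. q n \<in> G) \<Longrightarrow> q' \<in> G \<Longrightarrow> weakly_converges q q' \<Longrightarrow>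
      ereal (g q') \<le> liminf (\<lambda>n. ereal (g (q n)))"
    and coercive: "\<And>q. (\<forall>n. q n \<in> G) \<Longrightarrow> filterlim (\<lambda>n. norm (q n)) at_top sequentially \<Longrightarrow>
      filterlim (\<lambda>n. g (q n)) at_top sequentially"
  shows "\<exists>q'\<in>G. \<forall>q\<in>G. g q' \<le> g q"
proof -
  obtain q0 where q0: "q0 \<in> G"
    using G(1) by blast
  let ?H = "{q \<in> G. g q \<le> g q0}"
  \<comment> \<open>The infimum is formed in the extended reals, since \<open>g\<close> is not yet
    known to be bounded below.\<close>
  let ?I = "INF q\<in>?H. ereal (g q)"
  have "bounded ?H"
  proof (rule ccontr)
    assume unbounded: "\<not> bounded ?H"
    \<comment> \<open>Otherwise \<open>?H\<close> contains points of norm at least \<open>n\<close>,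
      along which coercivity would lift \<open>g\<close> above \<open>g q0\<close>.\<close>
    have "\<exists>q\<in>?H. real n \<le> norm q" for n
      using unbounded unfolding bounded_iff by (meson linear)
    then obtain q where q: "\<And>n. q n \<in> ?H" "\<And>n. real n \<le> norm (q n)"
      by metis
    have "filterlim (\<lambda>n. norm (q n)) at_top sequentially"
      using q(2) by (intro filterlim_at_top_mono[OF filterlim_real_sequentially]) auto
    then have "filterlim (\<lambda>n. g (q n)) at_top sequentially"
      using q(1) by (intro coercive) auto
    then have "\<forall>\<^sub>F n in sequentially. g q0 < g (q n)"
      by (simp add: filterlim_at_top_dense)
    moreover have "\<not> g q0 < g (q n)" for n
      using q(1)[of n] by simp
    ultimately show False by simp
  qed
  have "\<exists>f. (\<forall>n::nat. f n \<in> (\<lambda>q. ereal (g q)) ` ?H) \<and> f \<longlonglongrightarrow> ?I"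
    using q0 Inf_as_limit[of "(\<lambda>q. ereal (g q)) ` ?H"] by auto
  then obtain q where q: "\<And>n. q n \<in> ?H" "(\<lambda>n. ereal (g (q n))) \<longlonglongrightarrow> ?I"
    unfolding image_iff by (metis (no_types, lifting) ext)
  have "bounded (range q)"
    using \<open>bounded ?H\<close> q(1) by (intro bounded_subset[of ?H "range q"]) auto
  then obtain q' r where r: "strict_mono r" "weakly_converges (q \<circ> r) q'"
    by (rule reflexive_bounded_weakly_convergent_subsequence[OF refl])
  have "q' \<in> G"
    using r(2) G(2) q(1) unfolding limitin_weak_topology_wrt[symmetric]
    by (intro limitin_closedin[of _ _ q' sequentially]) auto
  moreover have "ereal (g q') \<le> ereal (g v)" if "v \<in> ?H" for v
  proof -
    have "ereal (g q') \<le> liminf (\<lambda>n. ereal (g ((q \<circ> r) n)))"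
      using q(1) \<open>q' \<in> G\<close> r(2) by (intro lsc) (auto simp: o_def)
    also have "\<dots> = ?I"
      using lim_imp_Liminf[OF sequentially_bot LIMSEQ_subseq_LIMSEQ[OF q(2) r(1)]] by (simp add: o_def)
    also have "\<dots> \<le> ereal (g v)"
      using that by (rule INF_lower)
    finally show ?thesis .
  qed
  \<comment> \<open>Points of \<open>G\<close> outside \<open>?H\<close> have values above
    \<open>g q0\<close>, and \<open>q0\<close> itself lies in \<open>?H\<close>.\<close>
  ultimately show ?thesis
    using q0 by (smt (verit) ereal_less_eq(3) mem_Collect_eq)
qed

section \<open>Existence of an optimal pair\<close>

theorem theorem11:
  fixes U :: "'q::banach set"
    and S :: "'t::real_normed_vector set"
    and \<Lambda> :: "('q \<times> 't) set"
    and \<pi> :: "'x::banach \<Rightarrow> 'y::{real_inner, complete_space}"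
    and K :: "'q \<times> 't \<Rightarrow> 'x set"
    and A :: "'q \<times> 't \<Rightarrow> 'x \<Rightarrow> ('x \<Rightarrow>\<^sub>L real)"
    and \<phi> :: "'q \<times> 't \<Rightarrow> 'x \<Rightarrow> 'x \<Rightarrow> real"
    and j :: "'q \<times> 't \<Rightarrow> 'x \<Rightarrow> real"
    and f :: "'q \<times> 't \<Rightarrow> 'y"
    and m \<alpha> \<beta> c0 c1 :: "'q \<times> 't \<Rightarrow> real"
    and sol :: "'q \<times> 't \<Rightarrow> 'x"
    and F :: "'t \<Rightarrow> 'q set"
    and \<L> :: "'x \<Rightarrow> 'q \<Rightarrow> real"
  assumes reflexive_X: "reflexive_space TYPE('x)"
    and reflexive_Q: "reflexive_space TYPE('q)"
    and U: "U \<noteq> {}" "closedin weak_topology U"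
    and S: "S \<noteq> {}" "closedin weak_topology S"
    and \<Lambda>: "\<Lambda> = U \<times> S"
    and \<pi>: "bounded_linear \<pi>"
    and K: "\<And>p. p \<in> \<Lambda> \<Longrightarrow> K p \<noteq> {} \<and> closed (K p) \<and> convex (K p)"
    and A_pseudomonotone: "\<And>p. p \<in> \<Lambda> \<Longrightarrow> pseudomonotone (A p)"
    and m_pos: "\<And>p. p \<in> \<Lambda> \<Longrightarrow> m p > 0"
    and A_strongly_monotone: "\<And>p v1 v2. p \<in> \<Lambda> \<Longrightarrow>
          blinfun_apply (A p v1 - A p v2) (v1 - v2) \<ge> m p * (norm (v1 - v2))\<^sup>2"
    and \<phi>_convex_lsc: "\<And>p u. p \<in> \<Lambda> \<Longrightarrow>
          convex_on UNIV (\<phi> p u) \<and> lower_semicontinuous (\<phi> p u)"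
    and \<alpha>_pos: "\<And>p. p \<in> \<Lambda> \<Longrightarrow> \<alpha> p > 0"
    and \<phi>_bound: "\<And>p u1 u2 v1 v2. p \<in> \<Lambda> \<Longrightarrow>
          \<phi> p u1 v2 - \<phi> p u1 v1 + \<phi> p u2 v1 - \<phi> p u2 v2
            \<le> \<alpha> p * norm (u1 - u2) * norm (v1 - v2)"
    and j_Lipschitz: "\<And>p. p \<in> \<Lambda> \<Longrightarrow> locally_Lipschitz (j p)"
    and c_nonneg: "\<And>p. p \<in> \<Lambda> \<Longrightarrow> c0 p \<ge> 0 \<and> c1 p \<ge> 0"
    and j_growth: "\<And>p v \<xi>. p \<in> \<Lambda> \<Longrightarrow> \<xi> \<in> Clarke_subdiff (j p) v \<Longrightarrow>
          norm \<xi> \<le> c0 p + c1 p * norm v"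
    and \<beta>_pos: "\<And>p. p \<in> \<Lambda> \<Longrightarrow> \<beta> p > 0"
    and j_bound: "\<And>p v1 v2. p \<in> \<Lambda> \<Longrightarrow>
          Clarke_dir (j p) v1 (v2 - v1) + Clarke_dir (j p) v2 (v1 - v2)
            \<le> \<beta> p * (norm (v1 - v2))\<^sup>2"
    and smallness: "\<And>p. p \<in> \<Lambda> \<Longrightarrow> \<alpha> p + \<beta> p < m p"
    and sol: "\<And>p. p \<in> \<Lambda> \<Longrightarrow> sol p = solution_P (K p) (A p) (\<phi> p) (j p) (f p) \<pi>"
    and sol_continuous: "\<And>ps p. (\<forall>n. ps n \<in> \<Lambda>) \<Longrightarrow> p \<in> \<Lambda> \<Longrightarrow>
          weakly_converges_wrt sum_norm ps p \<Longrightarrow> (\<lambda>n. sol (ps n)) \<longlonglongrightarrow> sol p"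
    and F: "\<And>\<eta>. \<eta> \<in> S \<Longrightarrow> F \<eta> \<subseteq> U \<and> F \<eta> \<noteq> {} \<and> closedin weak_topology (F \<eta>)"
    and \<L>_lsc: "\<And>us u qs q. (\<forall>k. qs k \<in> U) \<Longrightarrow> us \<longlonglongrightarrow> u \<Longrightarrow> weakly_converges qs q \<Longrightarrow>
          liminf (\<lambda>k. ereal (\<L> (us k) (qs k))) \<ge> ereal (\<L> u q)"
    and \<L>_diff: "\<And>us u qs q. (\<forall>k. qs k \<in> U) \<Longrightarrow> us \<longlonglongrightarrow> u \<Longrightarrow> weakly_converges qs q \<Longrightarrow>
          (\<lambda>k. \<L> (us k) (qs k) - \<L> u (qs k)) \<longlonglongrightarrow> 0"
    and coercive_or_bounded:
      "(\<exists>h :: 'q \<Rightarrow> real.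
          (\<forall>u. \<forall>q\<in>U. \<L> u q \<ge> h q) \<and>
          (\<forall>qs. (\<forall>k. qs k \<in> U) \<and> filterlim (\<lambda>k. norm (qs k)) at_top sequentially \<longrightarrow>
             filterlim (\<lambda>k. h (qs k)) at_top sequentially))
       \<or> bounded U"
  shows "\<forall>\<eta>\<in>S. \<exists>(u', q') \<in> admissible_pairs sol F \<eta>.
           \<forall>(u, q) \<in> admissible_pairs sol F \<eta>. \<L> u' q' \<le> \<L> u q"
proof
  fix \<eta>
  assume \<eta>: "\<eta> \<in> S"
  note F\<eta> = F[OF \<eta>]
  \<comment> \<open>The admissible pairs form the graph of
    \<open>q \<mapsto> sol (q, \<eta>)\<close> over \<open>F \<eta>\<close>, so only
    \<open>q\<close> has to be minimised over.\<close>
  have "\<exists>q'\<in>F \<eta>. \<forall>q\<in>F \<eta>. \<L> (sol (q', \<eta>)) q' \<le> \<L> (sol (q, \<eta>)) q"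
  proof (rule weakly_sequentially_lsc_attains_min[OF reflexive_Q])
    show "F \<eta> \<noteq> {}" "closedin weak_topology (F \<eta>)"
      using F\<eta> by auto
  next
    fix qs q'
    assume qs: "\<forall>n. qs n \<in> F \<eta>" and q': "q' \<in> F \<eta>" and w: "weakly_converges qs q'"
    \<comment> \<open>The states converge strongly although the controls converge only weakly, as
      the semicontinuity of \<open>\<L>\<close> requires.\<close>
    have "(\<lambda>n. sol (qs n, \<eta>)) \<longlonglongrightarrow> sol (q', \<eta>)"
      using qs q' F\<eta> \<eta> by (intro sol_continuous weakly_converges_sum_norm_Pair w) (auto simp: \<Lambda>)
    then show "ereal (\<L> (sol (q', \<eta>)) q') \<le> liminf (\<lambda>n. ereal (\<L> (sol (qs n, \<eta>)) (qs n)))"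
      using qs F\<eta> w by (intro \<L>_lsc) auto
  next
    fix qs
    assume qs: "\<forall>n. qs n \<in> F \<eta>" and lim: "filterlim (\<lambda>n. norm (qs n)) at_top sequentially"
    have U: "\<forall>n. qs n \<in> U"
      using qs F\<eta> by blast
    show "filterlim (\<lambda>n. \<L> (sol (qs n, \<eta>)) (qs n)) at_top sequentially"
      using coercive_or_bounded
    proof (elim disjE exE conjE)
      fix h :: "'q \<Rightarrow> real"
      assume h: "\<forall>u. \<forall>q\<in>U. h q \<le> \<L> u q"
        and "\<forall>qs. (\<forall>k. qs k \<in> U) \<and> filterlim (\<lambda>k. norm (qs k)) at_top sequentially \<longrightarrow>
             filterlim (\<lambda>k. h (qs k)) at_top sequentially"
      then have "filterlim (\<lambda>k. h (qs k)) at_top sequentially"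
        using U lim by blast
      then show ?thesis
        by (rule filterlim_at_top_mono) (use h U in auto)
    next
      \<comment> \<open>Here coercivity is vacuous: norms of points of \<open>U\<close> cannot tend
        to infinity.\<close>
      assume "bounded U"
      then obtain B where "\<forall>q\<in>U. norm q \<le> B"
        by (auto simp: bounded_iff)
      then have "\<not> B < norm (qs n)" for n
        using U by (simp add: not_less)
      moreover have "\<forall>\<^sub>F n in sequentially. B < norm (qs n)"
        using lim by (simp add: filterlim_at_top_dense)
      ultimately show ?thesis by simp
    qed
  qed
  then obtain q' where "q' \<in> F \<eta>"
      "\<And>q. q \<in> F \<eta> \<Longrightarrow> \<L> (sol (q', \<eta>)) q' \<le> \<L> (sol (q, \<eta>)) q"
    by blast
  then show "\<exists>(u', q') \<in> admissible_pairs sol F \<eta>.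
      \<forall>(u, q) \<in> admissible_pairs sol F \<eta>. \<L> u' q' \<le> \<L> u q"
    by (intro bexI[of _ "(sol (q', \<eta>), q')"]) (auto simp: admissible_pairs_def)
qed

end
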